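(* Let $\mathfrak{A}$ be a unital complex Jordan--Banach algebra. Then for all $a,b,c\in\mathfrak{A}$ the following formulae hold (limits in norm): $$\lim_{n\to\infty}\left(U_{e^{\frac{a}{n}},e^{\frac{c}{n}}}\left(e^{\frac{b}{n}}\right)\right)^{n}=e^{a+b+c},\qquad \lim_{n\to\infty}\left(U_{e^{\frac{a}{n}}}\left(e^{\frac{b}{n}}\right)\right)^{n}=e^{2a+b},$$ $$\text{and}\qquad \lim_{n\to\infty}\left(e^{\frac{a}{n}}\circ e^{\frac{b}{n}}\right)^{n}=e^{a+b}.$$
   Context: A complex Jordan--Banach algebra is a complex Banach space $\mathfrak{A}$ with a bilinear product $(a,b)\mapsto a\circ b$ satisfying $\|a\circ b\|\le\|a\|\,\|b\|$, $a\circ b=b\circ a$, and $(a^2\circ b)\circ a=(a\circ b)\circ a^2$ for all $a,b$ (where $a^2=a\circ a$). It is unital if there is $\mathbf{1}\in\mathfrak{A}$ with $\mathbf{1}\circ a=a$ for all $a$. Powers are $a^0=\mathbf{1}$, $a^{n+1}=a\circ a^n$, and $e^a=\sum_{n\ge 0}a^n/n!$. For $a,c\in\mathfrak{A}$, $U_{a,c}\colon\mathfrak{A}\to\mathfrak{A}$ is the linear map $U_{a,c}(b)=(a\circ b)\circ c+(c\circ b)\circ a-(a\circ c)\circ b$, and $U_a=U_{a,a}$, i.e. $U_a(b)=2(a\circ b)\circ a-a^2\circ b$. *)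

theory Defs
  imports "HOL-Analysis.Analysis"
begin

text \<open>
  A complex Banach space is a (real) Banach space whose real scalar multiplication and norm
  extend to the complex scalars.
\<close>

class complex_banach = banach +
  fixes scaleC :: "complex \<Rightarrow> 'a \<Rightarrow> 'a"  (infixr \<open>*\<^sub>C\<close> 75)
  assumes scaleC_add_right: "z *\<^sub>C (x + y) = z *\<^sub>C x + z *\<^sub>C y"
    and scaleC_add_left: "(z + w) *\<^sub>C x = z *\<^sub>C x + w *\<^sub>C x"
    and scaleC_scaleC: "z *\<^sub>C (w *\<^sub>C x) = (z * w) *\<^sub>C x"
    and scaleC_of_real: "of_real r *\<^sub>C x = r *\<^sub>R x"
    and norm_scaleC: "norm (z *\<^sub>C x) = cmod z * norm x"

text \<open>
  The Jordan product is written \<open>*\<close>. It is not assumed to be associative.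
\<close>

class jordan_banach_algebra = complex_banach + times +
  assumes jordan_add_left: "(a + b) * c = a * c + b * c"
    and jordan_add_right: "a * (b + c) = a * b + a * c"
    and jordan_scaleC_left: "(z *\<^sub>C a) * b = z *\<^sub>C (a * b)"
    and jordan_scaleC_right: "a * (z *\<^sub>C b) = z *\<^sub>C (a * b)"
    and jordan_norm_mult: "norm (a * b) \<le> norm a * norm b"
    and jordan_commute: "a * b = b * a"
    and jordan_identity: "((a * a) * b) * a = (a * b) * (a * a)"

text \<open>
  Class \<^class>\<open>power\<close> supplies \<open>a ^ 0 = 1\<close> and \<open>a ^ Suc n = a * a ^ n\<close> and requires no further
  axioms. Neither \<open>norm 1 = 1\<close> nor \<open>1 \<noteq> 0\<close> is assumed.
\<close>

class unital_jordan_banach_algebra = jordan_banach_algebra + power +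
  assumes jordan_one_left: "1 * a = a"

definition U2 :: "'a::jordan_banach_algebra \<Rightarrow> 'a \<Rightarrow> 'a \<Rightarrow> 'a" where
  "U2 a c b = (a * b) * c + (c * b) * a - (a * c) * b"

definition U :: "'a::jordan_banach_algebra \<Rightarrow> 'a \<Rightarrow> 'a" where
  "U a = U2 a a"

text \<open>
  The library's \<^const>\<open>exp\<close> is not available here, since it requires an associative product.
\<close>

definition jexp :: "'a::unital_jordan_banach_algebra \<Rightarrow> 'a" where
  "jexp a = (\<Sum>n. a ^ n /\<^sub>R fact n)"

lemma norm_jordan_power_le:
  fixes a :: "'a::unital_jordan_banach_algebra"
  shows "norm (a ^ n) \<le> norm a ^ n * norm (1::'a)"
proof (induction n)
  case (Suc n)
  have "norm (a ^ Suc n) \<le> norm a * norm (a ^ n)"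
    by (simp add: jordan_norm_mult)
  also have "\<dots> \<le> norm a * (norm a ^ n * norm (1::'a))"
    by (intro mult_left_mono Suc.IH norm_ge_zero)
  finally show ?case
    by (simp add: mult.assoc)
qed simp

lemma summable_jexp:
  fixes a :: "'a::unital_jordan_banach_algebra"
  shows "summable (\<lambda>n. a ^ n /\<^sub>R fact n)"
proof (rule summable_comparison_test')
  show "summable (\<lambda>n. (norm a ^ n /\<^sub>R fact n) * norm (1::'a))"
    by (intro summable_mult2 summable_exp_generic)
  show "norm (a ^ n /\<^sub>R fact n) \<le> (norm a ^ n /\<^sub>R fact n) * norm (1::'a)" for n
    using mult_left_mono[OF norm_jordan_power_le[of a n], of "inverse (fact n)"]
    by (simp add: mult.assoc)
qed

end

theory Submission
  imports Defs
begin

text \<open>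
  The power \<open>x ^ n\<close> is \<open>(L\<^sub>x)\<^sup>n 1\<close>, where \<open>L\<^sub>x\<close> is multiplication by \<open>x\<close>, and \<open>L\<^sub>1\<close> is the identity.
  Hence the binomial formula holds for \<open>(1 + h) ^ n\<close>, and \<open>(1 + s\<^sub>n/n) ^ n\<close> tends to \<open>jexp s\<close>
  whenever \<open>s\<^sub>n\<close> tends to \<open>s\<close>, by dominated convergence. It remains to expand each product of
  exponentials to first order in \<open>1/n\<close>.
\<close>

lemma bounded_bilinear_jordan_mult:
  "bounded_bilinear ((*) :: 'a \<Rightarrow> 'a \<Rightarrow> 'a::jordan_banach_algebra)"
proof
  fix a b :: 'a and r :: real
  show "(r *\<^sub>R a) * b = r *\<^sub>R (a * b)" "a * (r *\<^sub>R b) = r *\<^sub>R (a * b)"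
    by (metis jordan_scaleC_left scaleC_of_real) (metis jordan_scaleC_right scaleC_of_real)
  show "\<exists>K. \<forall>a b :: 'a. norm (a * b) \<le> norm a * norm b * K"
    by (rule exI[of _ 1]) (simp add: jordan_norm_mult)
qed (rule jordan_add_left jordan_add_right)+

interpretation jordan: bounded_bilinear "(*) :: 'a \<Rightarrow> 'a \<Rightarrow> 'a::jordan_banach_algebra"
  by (rule bounded_bilinear_jordan_mult)

lemma jordan_one_right: "a * 1 = (a :: 'a::unital_jordan_banach_algebra)"
  by (metis jordan_commute jordan_one_left)

lemma jordan_scaleR_power:
  fixes a :: "'a::unital_jordan_banach_algebra"
  shows "(r *\<^sub>R a) ^ n = r ^ n *\<^sub>R a ^ n"
  by (induction n) (simp_all add: jordan.scaleR_left jordan.scaleR_right)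

lemma tendsto_jordan_power:
  fixes f :: "'b \<Rightarrow> 'a::unital_jordan_banach_algebra"
  assumes "(f \<longlongrightarrow> a) F"
  shows "((\<lambda>x. f x ^ n) \<longlongrightarrow> a ^ n) F"
  by (induction n) (simp_all add: assms jordan.tendsto)

lemma jordan_binomial:
  fixes h :: "'a::unital_jordan_banach_algebra"
  shows "(1 + h) ^ n = (\<Sum>k\<le>n. real (n choose k) *\<^sub>R h ^ k)"
proof (induction n)
  case (Suc n)
  have "(1 + h) ^ Suc n = (1 + h) * (\<Sum>k\<le>n. real (n choose k) *\<^sub>R h ^ k)"
    by (simp add: Suc.IH)
  also have "\<dots> = (\<Sum>k\<le>n. real (n choose k) *\<^sub>R h ^ k) + (\<Sum>k\<le>n. real (n choose k) *\<^sub>R h ^ Suc k)"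
    by (simp add: jordan.add_left jordan_one_left jordan.sum_right jordan.scaleR_right
        scaleR_add_right sum.distrib)
  also have "(\<Sum>k\<le>n. real (n choose k) *\<^sub>R h ^ k) = (\<Sum>k\<le>Suc n. real (n choose k) *\<^sub>R h ^ k)"
    by (simp add: binomial_eq_0)
  also have "\<dots> = 1 + (\<Sum>k\<le>n. real (n choose Suc k) *\<^sub>R h ^ Suc k)"
    by (simp add: sum.atMost_Suc_shift del: sum.atMost_Suc power_Suc)
  finally have "(1 + h) ^ Suc n = 1 + (\<Sum>k\<le>n. real (Suc n choose Suc k) *\<^sub>R h ^ Suc k)"
    by (simp add: scaleR_add_left sum.distrib add_ac)
  then show ?case
    by (simp add: sum.atMost_Suc_shift del: sum.atMost_Suc power_Suc binomial_Suc_Suc)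
qed simp

text \<open>The library's \<open>tannerys_theorem\<close> is restricted to associative algebras.\<close>

lemma tendsto_suminf_dominated:
  fixes f :: "nat \<Rightarrow> 'b \<Rightarrow> 'a::banach"
  assumes lim: "\<And>k. (f k \<longlongrightarrow> g k) F"
    and bound: "\<forall>\<^sub>F x in F. \<forall>k. norm (f k x) \<le> M k"
    and "summable M" and "F \<noteq> bot"
  shows "((\<lambda>x. \<Sum>k. f k x) \<longlongrightarrow> (\<Sum>k. g k)) F"
proof -
  define S where "S = {x. \<forall>k. norm (f k x) \<le> M k}"
  have ev: "\<forall>\<^sub>F x in F. x \<in> S"
    using bound by (simp add: S_def)
  have unif: "uniform_limit S (\<lambda>n x. \<Sum>k<n. f k x) (\<lambda>x. \<Sum>k. f k x) sequentially"
    by (rule Weierstrass_m_test[where M = M]) (auto simp: S_def \<open>summable M\<close>)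
  have "norm (g k) \<le> M k" for k
    using \<open>F \<noteq> bot\<close> tendsto_norm[OF lim]
    by (rule tendsto_upperbound[rotated 2]) (use bound in \<open>auto elim: eventually_mono\<close>)
  then have "summable g"
    by (rule summable_comparison_test'[OF \<open>summable M\<close>])
  show ?thesis
  proof (rule swap_uniform_limit'[OF _ _ unif ev])
    show "\<forall>\<^sub>F n in sequentially. ((\<lambda>x. \<Sum>k<n. f k x) \<longlongrightarrow> (\<Sum>k<n. g k)) F"
      by (intro always_eventually allI tendsto_sum lim)
    show "(\<lambda>n. \<Sum>k<n. g k) \<longlonglongrightarrow> (\<Sum>k. g k)"
      by (rule summable_LIMSEQ[OF \<open>summable g\<close>])
  qed simp_all
qed

lemma binomial_over_power_tendsto:
  "(\<lambda>n. real (n choose k) / real n ^ k) \<longlonglongrightarrow> 1 / fact k"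
proof -
  have eq: "real (n choose k) / real n ^ k = (\<Prod>i<k. 1 - real i / real n) / fact k"
    if "n > 0" for n
  proof -
    have "real (n choose k) / real n ^ k = ((\<Prod>i<k. real n - real i) / real n ^ k) / fact k"
      by (simp add: binomial_gbinomial gbinomial_prod_rev atLeast0LessThan)
    also have "(\<Prod>i<k. real n - real i) / real n ^ k = (\<Prod>i<k. (real n - real i) / real n)"
      by (simp add: prod_dividef)
    finally show ?thesis
      using that by (simp add: diff_divide_distrib)
  qed
  have "(\<lambda>n. (\<Prod>i<k. 1 - real i / real n) / fact k) \<longlonglongrightarrow> (\<Prod>i<k. 1 - 0) / fact k"
    by (intro tendsto_divide tendsto_prod tendsto_diff tendsto_const lim_const_over_n) simp
  then have "(\<lambda>n. (\<Prod>i<k. 1 - real i / real n) / fact k) \<longlonglongrightarrow> 1 / fact k"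
    by simp
  then show ?thesis
    by (rule Lim_transform_eventually)
       (use eq in \<open>auto intro: eventually_mono[OF eventually_gt_at_top[of 0]]\<close>)
qed

lemma binomial_over_power_le: "real (n choose k) / real n ^ k \<le> 1 / fact k"
proof (cases "n = 0")
  case False
  have "real (n choose k) * fact k \<le> real n ^ k"
    using binomial_fact_pow[of n k] by (metis of_nat_fact of_nat_le_iff of_nat_mult of_nat_power)
  with False show ?thesis
    by (simp add: field_simps)
qed (cases k; simp)

lemma power_one_plus_tendsto_jexp:
  fixes s :: "'a::unital_jordan_banach_algebra"
  assumes lim: "S \<longlonglongrightarrow> s"
  shows "(\<lambda>n. (1 + S n /\<^sub>R real n) ^ n) \<longlonglongrightarrow> jexp s"
proof -
  define f where "f k n = (real (n choose k) / real n ^ k) *\<^sub>R S n ^ k" for k n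
  obtain K where K: "\<And>n. norm (S n) \<le> K"
    using convergent_imp_Bseq[of S] lim by (auto simp: convergent_def Bseq_def)
  have sum: "(\<Sum>k. f k n) = (1 + S n /\<^sub>R real n) ^ n" for n
  proof -
    have "(\<Sum>k. f k n) = (\<Sum>k\<le>n. f k n)"
      by (rule suminf_finite) (auto simp: f_def binomial_eq_0)
    also have "\<dots> = (1 + S n /\<^sub>R real n) ^ n"
      by (simp add: f_def jordan_binomial jordan_scaleR_power divide_inverse power_inverse)
    finally show ?thesis .
  qed
  have "(\<lambda>n. \<Sum>k. f k n) \<longlonglongrightarrow> (\<Sum>k. s ^ k /\<^sub>R fact k)"
  proof (rule tendsto_suminf_dominated)
    show "f k \<longlonglongrightarrow> s ^ k /\<^sub>R fact k" for k
      unfolding f_def using binomial_over_power_tendsto[of k] tendsto_jordan_power[OF lim, of k]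
      by (auto simp: inverse_eq_divide intro: tendsto_scaleR)
    show "\<forall>\<^sub>F n in sequentially. \<forall>k. norm (f k n) \<le> (K ^ k /\<^sub>R fact k) * norm (1::'a)"
    proof (intro always_eventually allI)
      fix n k
      have "norm (f k n) \<le> (1 / fact k) * (norm (S n) ^ k * norm (1::'a))"
        using mult_mono[OF binomial_over_power_le[of n k] norm_jordan_power_le[of "S n" k]]
        by (simp add: f_def)
      also have "\<dots> \<le> (1 / fact k) * (K ^ k * norm (1::'a))"
        by (intro mult_left_mono mult_right_mono power_mono K) auto
      finally show "norm (f k n) \<le> (K ^ k /\<^sub>R fact k) * norm (1::'a)"
        by (simp add: inverse_eq_divide)
    qed
    show "summable (\<lambda>k. (K ^ k /\<^sub>R fact k) * norm (1::'a))"
      by (intro summable_mult2 summable_exp_generic)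
  qed simp
  then show ?thesis
    by (simp add: sum jexp_def)
qed

definition tangent :: "(nat \<Rightarrow> 'a::unital_jordan_banach_algebra) \<Rightarrow> 'a \<Rightarrow> bool" where
  "tangent X s \<longleftrightarrow> (\<lambda>n. real n *\<^sub>R (X n - 1)) \<longlonglongrightarrow> s"

lemma tangent_power_tendsto:
  assumes "tangent X s"
  shows "(\<lambda>n. X n ^ n) \<longlonglongrightarrow> jexp s"
proof (rule Lim_transform_eventually)
  show "(\<lambda>n. (1 + (real n *\<^sub>R (X n - 1)) /\<^sub>R real n) ^ n) \<longlonglongrightarrow> jexp s"
    using assms unfolding tangent_def by (rule power_one_plus_tendsto_jexp)
  show "\<forall>\<^sub>F n in sequentially. (1 + (real n *\<^sub>R (X n - 1)) /\<^sub>R real n) ^ n = X n ^ n"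
    using eventually_gt_at_top[of 0] by eventually_elim simp
qed

lemma tangent_tendsto_one:
  assumes "tangent X s"
  shows "X \<longlonglongrightarrow> 1"
proof (rule Lim_transform_eventually)
  show "(\<lambda>n. 1 + inverse (real n) *\<^sub>R (real n *\<^sub>R (X n - 1))) \<longlonglongrightarrow> 1"
    using tendsto_add[OF tendsto_const tendsto_scaleR[OF lim_inverse_n assms[unfolded tangent_def]]]
    by simp
  show "\<forall>\<^sub>F n in sequentially. 1 + inverse (real n) *\<^sub>R (real n *\<^sub>R (X n - 1)) = X n"
    using eventually_gt_at_top[of 0] by eventually_elim simp
qed

lemma tangent_mult:
  assumes "tangent X s" "tangent Y t"
  shows "tangent (\<lambda>n. X n * Y n) (s + t)"
proof -
  have "(\<lambda>n. (real n *\<^sub>R (X n - 1)) * Y n + real n *\<^sub>R (Y n - 1)) \<longlonglongrightarrow> s * 1 + t"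
    using assms tangent_tendsto_one[OF assms(2)]
    by (auto simp: tangent_def intro!: tendsto_add jordan.tendsto)
  then show ?thesis
    by (simp add: tangent_def jordan.scaleR_left jordan.diff_left jordan_one_left
        jordan_one_right algebra_simps)
qed

lemma tangent_add_diff:
  assumes "tangent X s" "tangent Y t" "tangent Z u"
  shows "tangent (\<lambda>n. X n + Y n - Z n) (s + t - u)"
  using tendsto_diff[OF tendsto_add[OF assms(1,2)[unfolded tangent_def]] assms(3)[unfolded tangent_def]]
  by (simp add: tangent_def algebra_simps)

lemma tangent_jexp:
  fixes a :: "'a::unital_jordan_banach_algebra"
  shows "tangent (\<lambda>n. jexp (a /\<^sub>R real n)) a"
proof -
  define f where "f k n = (inverse (real n) ^ k / fact (Suc k)) *\<^sub>R a ^ Suc k" for k n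
  have eq: "(\<Sum>k. f k n) = real n *\<^sub>R (jexp (a /\<^sub>R real n) - 1)" if "n > 0" for n
  proof -
    have term_eq: "real n *\<^sub>R ((a /\<^sub>R real n) ^ Suc k /\<^sub>R fact (Suc k)) = f k n" for k
      using that by (simp add: f_def jordan_scaleR_power jordan.scaleR_left jordan.scaleR_right
          field_simps del: fact_Suc)
    have "jexp (a /\<^sub>R real n) - 1 = (\<Sum>k. (a /\<^sub>R real n) ^ Suc k /\<^sub>R fact (Suc k))"
      using suminf_split_head[OF summable_jexp[of "a /\<^sub>R real n"]]
      by (simp add: jexp_def del: power_Suc fact_Suc)
    moreover have "summable (\<lambda>k. (a /\<^sub>R real n) ^ Suc k /\<^sub>R fact (Suc k))"
      using summable_jexp[of "a /\<^sub>R real n"] by (subst summable_Suc_iff)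
    ultimately have "real n *\<^sub>R (jexp (a /\<^sub>R real n) - 1) =
        (\<Sum>k. real n *\<^sub>R ((a /\<^sub>R real n) ^ Suc k /\<^sub>R fact (Suc k)))"
      by (simp add: suminf_scaleR_right del: power_Suc fact_Suc)
    then show ?thesis
      by (simp only: term_eq)
  qed
  have "(\<lambda>n. \<Sum>k. f k n) \<longlonglongrightarrow> (\<Sum>k. if k = 0 then a else 0)"
  proof (rule tendsto_suminf_dominated)
    show "f k \<longlonglongrightarrow> (if k = 0 then a else 0)" for k
    proof (cases "k = 0")
      case True
      then have "f k = (\<lambda>_. a)"
        by (simp add: fun_eq_iff f_def jordan_one_right)
      with True show ?thesis by simp
    next
      case False
      have "f k \<longlonglongrightarrow> (0 ^ k / fact (Suc k)) *\<^sub>R a ^ Suc k"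
        unfolding f_def
        by (intro tendsto_scaleR tendsto_divide tendsto_power lim_inverse_n tendsto_const) simp
      with False show ?thesis by (simp add: power_0_left)
    qed
    show "\<forall>\<^sub>F n in sequentially. \<forall>k. norm (f k n) \<le> (norm a ^ Suc k /\<^sub>R fact (Suc k)) * norm (1::'a)"
    proof (intro always_eventually allI)
      fix n k
      have "inverse (real n) ^ k \<le> 1"
        by (rule power_le_one) (cases n; simp add: field_simps)+
      then have "inverse (real n) ^ k / fact (Suc k) \<le> 1 / fact (Suc k)"
        by (intro divide_right_mono) auto
      from mult_mono[OF this norm_jordan_power_le[of a "Suc k"]]
      show "norm (f k n) \<le> (norm a ^ Suc k /\<^sub>R fact (Suc k)) * norm (1::'a)"
        by (simp add: f_def inverse_eq_divide del: power_Suc fact_Suc)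
    qed
    show "summable (\<lambda>k. (norm a ^ Suc k /\<^sub>R fact (Suc k)) * norm (1::'a))"
      by (subst summable_Suc_iff) (intro summable_mult2 summable_exp_generic)
  qed simp
  moreover have "(\<Sum>k. if k = 0 then a else 0) = a"
    using suminf_finite[of "{0}" "\<lambda>k. if k = 0 then a else 0"] by simp
  ultimately have "(\<lambda>n. \<Sum>k. f k n) \<longlonglongrightarrow> a"
    by simp
  then show ?thesis
    unfolding tangent_def
    by (rule Lim_transform_eventually)
       (use eq in \<open>auto intro: eventually_mono[OF eventually_gt_at_top[of 0]]\<close>)
qed

lemma tangent_U2:
  assumes "tangent X s" "tangent Y t" "tangent Z u"
  shows "tangent (\<lambda>n. U2 (X n) (Z n) (Y n)) (s + t + u)"
proof -
  have "tangent (\<lambda>n. U2 (X n) (Z n) (Y n)) (((s + t) + u) + ((u + t) + s) - ((s + u) + t))"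
    unfolding U2_def by (intro tangent_add_diff tangent_mult assms)
  then show ?thesis
    by (simp add: algebra_simps)
qed

theorem corollary2p2:
  fixes a b c :: "'a::unital_jordan_banach_algebra"
  shows "((\<lambda>n::nat. (U2 (jexp (a /\<^sub>R real n)) (jexp (c /\<^sub>R real n)) (jexp (b /\<^sub>R real n))) ^ n)
            \<longlonglongrightarrow> jexp (a + b + c)) \<and>
         ((\<lambda>n::nat. (U (jexp (a /\<^sub>R real n)) (jexp (b /\<^sub>R real n))) ^ n)
            \<longlonglongrightarrow> jexp (2 *\<^sub>R a + b)) \<and>
         ((\<lambda>n::nat. (jexp (a /\<^sub>R real n) * jexp (b /\<^sub>R real n)) ^ n)
            \<longlonglongrightarrow> jexp (a + b))"
proof (intro conjI)
  have "tangent (\<lambda>n. U (jexp (a /\<^sub>R real n)) (jexp (b /\<^sub>R real n))) (a + b + a)"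
    unfolding U_def by (rule tangent_U2[OF tangent_jexp tangent_jexp tangent_jexp])
  also have "a + b + a = 2 *\<^sub>R a + b"
    by (simp add: scaleR_2)
  finally show "(\<lambda>n. (U (jexp (a /\<^sub>R real n)) (jexp (b /\<^sub>R real n))) ^ n) \<longlonglongrightarrow> jexp (2 *\<^sub>R a + b)"
    by (rule tangent_power_tendsto)
  show "(\<lambda>n. (U2 (jexp (a /\<^sub>R real n)) (jexp (c /\<^sub>R real n)) (jexp (b /\<^sub>R real n))) ^ n)
      \<longlonglongrightarrow> jexp (a + b + c)"
    by (rule tangent_power_tendsto[OF tangent_U2[OF tangent_jexp tangent_jexp tangent_jexp]])
  show "(\<lambda>n. (jexp (a /\<^sub>R real n) * jexp (b /\<^sub>R real n)) ^ n) \<longlonglongrightarrow> jexp (a + b)"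
    by (rule tangent_power_tendsto[OF tangent_mult[OF tangent_jexp tangent_jexp]])
qed

end
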